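(* Let $\phi$ be an updating rule, $\mathcal{P}$ a class of true densities, and $\Omega_{t-1}$ a (symmetric) positive definite $k\times k$ weighting matrix known given $\mathcal{F}_{t-1}$. Assume: (1) $\Theta\subseteq\mathbb{R}^k$ is open and convex, $\vartheta_{t|t-1}\in\Theta$ and $\vartheta_{t|t}(Y_t)=\phi(Y_t,\vartheta_{t|t-1})\in\Theta$ (almost surely); (2) $\log f(x|\vartheta)$ is twice continuously differentiable in $\vartheta$ for all $\vartheta\in\Theta$ and $x\in\mathcal{Y}$; (3) $\mathbb{E}_{p_t}[s(X_t,\vartheta_{t|t-1})]$ and $\mathbb{E}_{p_t}[\|\Delta\phi(Y_t,\vartheta_{t|t-1})\|^2]$ are finite for all $\vartheta_{t|t-1}\in\Theta$ and $p_t\in\mathcal{P}$. Then, for all $p_t\in\mathcal{P}$ and $\vartheta_{t|t-1}\in\Theta$, the following are equivalent: (a) $\mathbb{E}_{p_t}[\Delta\phi(Y_t,\vartheta_{t|t-1})]^\top\,\Omega_{t-1}\,(\vartheta_t^\ast-\vartheta_{t|t-1})>0$; (b) there exists $\bar\kappa>0$ (with $\bar\kappa\le1$) such that for all $\kappa\in(0,\bar\kappa]$: $\Delta^{\mathsf{MSE}}(\phi_\kappa|\vartheta_{t|t-1},p_t)<0$.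
   Context: Setting. Let $\mathcal{Y}\subseteq\mathbb{R}^l$ be the outcome space and fix a time $t$. Conditionally on the information set $\mathcal{F}_{t-1}$ at time $t-1$, the observation $Y_t$ has true density $p_t$ on $\mathcal{Y}$, belonging to a class $\mathcal{P}$ of absolutely continuous distributions. Quantities known given $\mathcal{F}_{t-1}$, such as the predicted parameter $\vartheta_{t|t-1}\in\Theta$ and $\Omega_{t-1}$, are treated as fixed. $\mathbb{E}_{p_t}$ denotes expectation under $p_t$, and $X_t$ denotes an independent copy of $Y_t$. The postulated (possibly misspecified) model is a family of densities $f(\cdot|\vartheta)$, $\vartheta\in\Theta\subseteq\mathbb{R}^k$; the support of $p_t$ is contained in the support of $f(\cdot|\vartheta)$ for all $\vartheta\in\Theta$. The score is $s(y,\vartheta)=\frac{\partial}{\partial\vartheta}\log f(y|\vartheta)$. $\|\cdot\|$ is the Euclidean norm. The pseudo-true parameter is $\vartheta_t^\ast:=\arg\max_{\vartheta\in\Theta}\mathbb{E}_{p_t}[\log f(Y_t|\vartheta)]$, assumed to exist in $\Theta$. Updating rules. An updating rule is a map $\phi:\mathcal{Y}\times\Theta\to\Theta$; the updated parameter is $\vartheta_{t|t}(y)=\phi(y,\vartheta_{t|t-1})$ and $\Delta\phi(y,\vartheta_{t|t-1}):=\vartheta_{t|t}(y)-\vartheta_{t|t-1}$. For $0<\kappa\le 1$, the linearly downscaled rule is $\phi_\kappa(y,\vartheta_{t|t-1})=\vartheta_{t|t-1}+\kappa\,\Delta\phi(y,\vartheta_{t|t-1})$. MSE. For an updating rule $\phi$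 with updated parameter $\vartheta_{t|t}(Y_t)$, $$\mathsf{MSE}(p_t\Vert f_{t|t}):=\mathbb{E}_{p_t}\big[(\vartheta_{t|t}(Y_t)-\vartheta_t^\ast)^\top\Omega_{t-1}(\vartheta_{t|t}(Y_t)-\vartheta_t^\ast)\big],$$ $\mathsf{MSE}(p_t\Vert f_{t|t-1})$ is the same expression with $\vartheta_{t|t}(Y_t)$ replaced by $\vartheta_{t|t-1}$, and $\Delta^{\mathsf{MSE}}(\phi|\vartheta_{t|t-1},p_t):=\mathsf{MSE}(p_t\Vert f_{t|t})-\mathsf{MSE}(p_t\Vert f_{t|t-1})$. *)

theory Defs
  imports "HOL-Probability.Probability"
begin

text \<open>Densities are taken with respect to Lebesgue measure on the outcome space \<open>Y\<close>; values of
  a density outside \<open>Y\<close> are irrelevant.\<close>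

definition law :: "(real^'l) set \<Rightarrow> (real^'l \<Rightarrow> real) \<Rightarrow> (real^'l) measure" where
  "law Y p = density (restrict_space lborel Y) (\<lambda>y. ennreal (p y))"

definition is_density :: "(real^'l) set \<Rightarrow> (real^'l \<Rightarrow> real) \<Rightarrow> bool" where
  "is_density Y p \<longleftrightarrow>
     p \<in> borel_measurable (restrict_space lborel Y) \<and> (\<forall>y\<in>Y. 0 \<le> p y) \<and> prob_space (law Y p)"

definition density_support :: "(real^'l) set \<Rightarrow> (real^'l \<Rightarrow> real) \<Rightarrow> (real^'l) set" where
  "density_support Y p = {y \<in> Y. 0 < p y}"

definition C2_on :: "(real^'k) set \<Rightarrow> (real^'k \<Rightarrow> real) \<Rightarrow> bool" where
  "C2_on S g \<longleftrightarrow>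
     (\<exists>(G :: real^'k \<Rightarrow> real^'k) (H :: real^'k \<Rightarrow> real^'k^'k).
        (\<forall>x\<in>S. GDERIV g x :> G x) \<and>
        (\<forall>x\<in>S. (G has_derivative (\<lambda>h. H x *v h)) (at x)) \<and>
        continuous_on S H)"

definition score :: "(real^'l \<Rightarrow> real^'k \<Rightarrow> real) \<Rightarrow> real^'l \<Rightarrow> real^'k \<Rightarrow> real^'k" where
  "score f y \<theta> = (THE D. GDERIV (\<lambda>\<theta>'. ln (f y \<theta>')) \<theta> :> D)"

text \<open>The expected log-likelihood may be infinite for some parameters, where the Bochner integral
  would return 0. It is therefore taken in the extended reals, where it is meaningful unless the
  positive and the negative part both have infinite integral.\<close>

definition expectation_exists :: "'a measure \<Rightarrow> ('a \<Rightarrow> real) \<Rightarrow> bool" where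
  "expectation_exists M g \<longleftrightarrow>
     (\<integral>\<^sup>+ y. ennreal (g y) \<partial>M) < \<infinity> \<or> (\<integral>\<^sup>+ y. ennreal (- g y) \<partial>M) < \<infinity>"

definition ereal_expectation :: "'a measure \<Rightarrow> ('a \<Rightarrow> real) \<Rightarrow> ereal" where
  "ereal_expectation M g =
     enn2ereal (\<integral>\<^sup>+ y. ennreal (g y) \<partial>M) - enn2ereal (\<integral>\<^sup>+ y. ennreal (- g y) \<partial>M)"

definition is_pseudo_true ::
  "(real^'l) set \<Rightarrow> (real^'k) set \<Rightarrow> (real^'l \<Rightarrow> real^'k \<Rightarrow> real) \<Rightarrow> (real^'l \<Rightarrow> real) \<Rightarrow> real^'k \<Rightarrow> bool"
where
  "is_pseudo_true Y \<Theta> f p \<theta>s \<longleftrightarrow>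
     (\<forall>\<theta>\<in>\<Theta>. expectation_exists (law Y p) (\<lambda>y. ln (f y \<theta>))) \<and>
     is_arg_max (\<lambda>\<theta>. ereal_expectation (law Y p) (\<lambda>y. ln (f y \<theta>))) (\<lambda>\<theta>. \<theta> \<in> \<Theta>) \<theta>s"

definition upd_diff :: "(real^'l \<Rightarrow> real^'k \<Rightarrow> real^'k) \<Rightarrow> real^'l \<Rightarrow> real^'k \<Rightarrow> real^'k" where
  "upd_diff \<phi> y \<theta> = \<phi> y \<theta> - \<theta>"

definition downscaled ::
  "(real^'l \<Rightarrow> real^'k \<Rightarrow> real^'k) \<Rightarrow> real \<Rightarrow> real^'l \<Rightarrow> real^'k \<Rightarrow> real^'k" where
  "downscaled \<phi> \<kappa> y \<theta> = \<theta> + \<kappa> *\<^sub>R upd_diff \<phi> y \<theta>"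

definition sym_pos_def :: "real^'k^'k \<Rightarrow> bool" where
  "sym_pos_def \<Omega> \<longleftrightarrow> transpose \<Omega> = \<Omega> \<and> (\<forall>v. v \<noteq> 0 \<longrightarrow> 0 < v \<bullet> (\<Omega> *v v))"

definition mse ::
  "(real^'l) measure \<Rightarrow> real^'k^'k \<Rightarrow> real^'k \<Rightarrow> (real^'l \<Rightarrow> real^'k) \<Rightarrow> real" where
  "mse M \<Omega> \<theta>s u = (\<integral>y. (u y - \<theta>s) \<bullet> (\<Omega> *v (u y - \<theta>s)) \<partial>M)"

definition delta_mse ::
  "(real^'l) measure \<Rightarrow> real^'k^'k \<Rightarrow> real^'k \<Rightarrow> (real^'l \<Rightarrow> real^'k \<Rightarrow> real^'k) \<Rightarrow> real^'k \<Rightarrow> real" where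
  "delta_mse M \<Omega> \<theta>s \<phi> \<theta> = mse M \<Omega> \<theta>s (\<lambda>y. \<phi> y \<theta>) - mse M \<Omega> \<theta>s (\<lambda>_. \<theta>)"

end

theory Submission
  imports Defs
begin

text \<open>
  Write \<open>D\<close> for the random update step and \<open>d = \<theta>s - \<theta>\<close> for the displacement from the prediction
  to the target. Downscaling by \<open>\<kappa>\<close> replaces the error \<open>-d\<close> of the prediction by \<open>\<kappa> D - d\<close>, and
  expanding the quadratic form of the symmetric matrix \<open>\<Omega>\<close> gives

    \<open>delta MSE = \<kappa> (\<kappa> A - 2 B)\<close>   with   \<open>A = E[D \<bullet> \<Omega> D] \<ge> 0\<close>   and   \<open>B = E[D] \<bullet> \<Omega> d\<close>

  (lemma \<open>delta_mse_downscaled\<close>). The second moment of the step guarantees that both expectations are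
  finite. For small \<open>\<kappa>\<close> the linear term decides the sign: if \<open>B > 0\<close> it dominates as
  long as \<open>\<kappa> A < 2 B\<close>, and conversely, since \<open>A \<ge> 0\<close>, the MSE cannot decrease for even one
  \<open>\<kappa> > 0\<close> unless \<open>B > 0\<close> (lemma \<open>quadratic_negative_near_zero_iff\<close>).
\<close>

lemma symmetric_quadratic_form_diff:
  fixes \<Omega> :: "real^'k^'k"
  assumes "transpose \<Omega> = \<Omega>"
  shows "(x - d) \<bullet> (\<Omega> *v (x - d)) = x \<bullet> (\<Omega> *v x) - 2 * (x \<bullet> (\<Omega> *v d)) + d \<bullet> (\<Omega> *v d)"
proof -
  have "d \<bullet> (\<Omega> *v x) = x \<bullet> (\<Omega> *v d)"
    using assms by (metis dot_lmul_matrix inner_commute transpose_matrix_vector)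
  then show ?thesis
    by (simp add: matrix_vector_mult_diff_distrib inner_diff_left inner_diff_right)
qed

text \<open>On a finite measure space constants are integrable, so \<open>r \<le> 1 + r\<^sup>2\<close> turns a second moment
  into a first moment.\<close>

lemma square_integrable_imp_integrable_vector:
  fixes D :: "'a \<Rightarrow> 'b::{second_countable_topology, banach}"
  assumes "finite_measure M" "D \<in> borel_measurable M"
    and sq: "integrable M (\<lambda>y. (norm (D y))\<^sup>2)"
  shows "integrable M D"
proof (rule Bochner_Integration.integrable_bound)
  interpret finite_measure M by fact
  show "integrable M (\<lambda>y. 1 + (norm (D y))\<^sup>2)"
    using sq by simp
  have "r \<le> 1 + r\<^sup>2" for r :: real
  proof -
    have "0 \<le> (r - 1/2)\<^sup>2" by simp
    then show ?thesis by (simp add: power2_eq_square algebra_simps)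
  qed
  then show "AE y in M. norm (D y) \<le> norm (1 + (norm (D y))\<^sup>2)"
    by simp
qed fact

text \<open>The matrix acts as a bounded operator, so Cauchy-Schwarz bounds its quadratic form by a multiple
  of the squared norm.\<close>

lemma integrable_quadratic_form:
  fixes D :: "'a \<Rightarrow> real^'k" and \<Omega> :: "real^'k^'k"
  assumes [measurable]: "D \<in> borel_measurable M"
    and sq: "integrable M (\<lambda>y. (norm (D y))\<^sup>2)"
  shows "integrable M (\<lambda>y. D y \<bullet> (\<Omega> *v D y))"
proof -
  have lin: "bounded_linear ((*v) \<Omega>)"
    by (rule matrix_vector_mul_bounded_linear)
  then obtain K where K: "\<And>x. norm (\<Omega> *v x) \<le> norm x * K"
    using bounded_linear.pos_bounded by blast
  have [measurable]: "(\<lambda>y. \<Omega> *v D y) \<in> borel_measurable M"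
    by (rule measurable_compose[OF assms(1)])
      (intro borel_measurable_continuous_onI linear_continuous_on lin)
  show ?thesis
  proof (rule Bochner_Integration.integrable_bound)
    show "integrable M (\<lambda>y. K * (norm (D y))\<^sup>2)"
      using sq by simp
    have "\<bar>x \<bullet> (\<Omega> *v x)\<bar> \<le> K * (norm x)\<^sup>2" for x
    proof -
      have "\<bar>x \<bullet> (\<Omega> *v x)\<bar> \<le> norm x * norm (\<Omega> *v x)"
        by (rule Cauchy_Schwarz_ineq2)
      also have "\<dots> \<le> norm x * (norm x * K)"
        by (intro mult_left_mono K norm_ge_zero)
      finally show ?thesis by (simp add: power2_eq_square mult_ac)
    qed
    then show "AE y in M. norm (D y \<bullet> (\<Omega> *v D y)) \<le> norm (K * (norm (D y))\<^sup>2)"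
      by (smt (verit) AE_I2 real_norm_def)
  qed measurable
qed

text \<open>The term \<open>d \<bullet> \<Omega> d\<close> of the expanded error is the MSE of the prediction, because the measure has
  total mass one. It cancels in the difference, which leaves a polynomial in \<open>\<kappa>\<close> without constant
  term.\<close>

lemma delta_mse_downscaled:
  fixes \<phi> :: "real^'l \<Rightarrow> real^'k \<Rightarrow> real^'k" and \<Omega> :: "real^'k^'k"
  assumes "prob_space M" and sym: "transpose \<Omega> = \<Omega>"
    and meas: "(\<lambda>y. upd_diff \<phi> y \<theta>) \<in> borel_measurable M"
    and sq: "integrable M (\<lambda>y. (norm (upd_diff \<phi> y \<theta>))\<^sup>2)"
  shows "delta_mse M \<Omega> \<theta>s (downscaled \<phi> \<kappa>) \<theta> =
    \<kappa> * (\<kappa> * (\<integral>y. upd_diff \<phi> y \<theta> \<bullet> (\<Omega> *v upd_diff \<phi> y \<theta>) \<partial>M)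
       - 2 * ((\<integral>y. upd_diff \<phi> y \<theta> \<partial>M) \<bullet> (\<Omega> *v (\<theta>s - \<theta>))))"
proof -
  interpret prob_space M by fact
  define D where "D = (\<lambda>y. upd_diff \<phi> y \<theta>)"
  define d where "d = \<theta>s - \<theta>"
  have int_D: "integrable M D"
    unfolding D_def using finite_measure_axioms meas sq
    by (rule square_integrable_imp_integrable_vector)
  have int_Q: "integrable M (\<lambda>y. D y \<bullet> (\<Omega> *v D y))"
    unfolding D_def using meas sq by (rule integrable_quadratic_form)
  have err: "(downscaled \<phi> \<kappa> y \<theta> - \<theta>s) \<bullet> (\<Omega> *v (downscaled \<phi> \<kappa> y \<theta> - \<theta>s)) =
      \<kappa>\<^sup>2 * (D y \<bullet> (\<Omega> *v D y)) - 2 * \<kappa> * (D y \<bullet> (\<Omega> *v d)) + d \<bullet> (\<Omega> *v d)" for y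
  proof -
    have "downscaled \<phi> \<kappa> y \<theta> - \<theta>s = \<kappa> *\<^sub>R D y - d"
      by (simp add: downscaled_def D_def d_def)
    then show ?thesis
      by (simp add: symmetric_quadratic_form_diff[OF sym] matrix_vector_mult_scaleR power2_eq_square)
  qed
  have prior: "(\<theta> - \<theta>s) \<bullet> (\<Omega> *v (\<theta> - \<theta>s)) = d \<bullet> (\<Omega> *v d)"
    using symmetric_quadratic_form_diff[OF sym, of 0 d] by (simp add: d_def)
  have "delta_mse M \<Omega> \<theta>s (downscaled \<phi> \<kappa>) \<theta> =
      \<kappa>\<^sup>2 * (\<integral>y. D y \<bullet> (\<Omega> *v D y) \<partial>M) - 2 * \<kappa> * ((\<integral>y. D y \<partial>M) \<bullet> (\<Omega> *v d))"
    unfolding delta_mse_def mse_def err prior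
    using int_D int_Q by (simp add: prob_space)
  then show ?thesis
    by (simp add: D_def d_def power2_eq_square algebra_simps)
qed

text \<open>A parabola through the origin that opens upwards dips below zero immediately to the right of the
  origin exactly when its slope \<open>- 2 B\<close> there is negative. The degenerate case \<open>A = 0\<close> of a line is
  included.\<close>

lemma quadratic_negative_near_zero_iff:
  fixes A B :: real
  assumes "0 \<le> A"
  shows "0 < B \<longleftrightarrow> (\<exists>\<kappa>b. 0 < \<kappa>b \<and> \<kappa>b \<le> 1 \<and> (\<forall>\<kappa>\<in>{0<..\<kappa>b}. \<kappa> * (\<kappa> * A - 2 * B) < 0))"
proof
  assume "0 < B"
  \<comment> \<open>On this range \<open>\<kappa> A \<le> B < 2 B\<close>; the \<open>+ 1\<close> keeps the denominator positive when \<open>A = 0\<close>.\<close>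
  define \<kappa>b where "\<kappa>b = min 1 (B / (A + 1))"
  have "\<kappa> * (\<kappa> * A - 2 * B) < 0" if "\<kappa> \<in> {0<..\<kappa>b}" for \<kappa>
  proof -
    have "0 < \<kappa>" and "\<kappa> \<le> B / (A + 1)"
      using that by (auto simp: \<kappa>b_def)
    then have "\<kappa> * (A + 1) \<le> B"
      using assms by (simp add: pos_le_divide_eq)
    then have "\<kappa> * A - 2 * B < 0"
      using \<open>0 < \<kappa>\<close> \<open>0 < B\<close> by (simp add: algebra_simps)
    then show ?thesis
      using \<open>0 < \<kappa>\<close> by (simp add: mult_less_0_iff)
  qed
  moreover have "0 < \<kappa>b" "\<kappa>b \<le> 1"
    using \<open>0 < B\<close> assms by (auto simp: \<kappa>b_def)
  ultimately show "\<exists>\<kappa>b. 0 < \<kappa>b \<and> \<kappa>b \<le> 1 \<and> (\<forall>\<kappa>\<in>{0<..\<kappa>b}. \<kappa> * (\<kappa> * A - 2 * B) < 0)"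
    by blast
next
  assume "\<exists>\<kappa>b. 0 < \<kappa>b \<and> \<kappa>b \<le> 1 \<and> (\<forall>\<kappa>\<in>{0<..\<kappa>b}. \<kappa> * (\<kappa> * A - 2 * B) < 0)"
  then obtain \<kappa> where "0 < \<kappa>" and "\<kappa> * (\<kappa> * A - 2 * B) < 0"
    by force
  then have "\<kappa> * A < 2 * B"
    by (simp add: mult_less_0_iff)
  moreover have "0 \<le> \<kappa> * A"
    using \<open>0 < \<kappa>\<close> assms by simp
  ultimately show "0 < B"
    by linarith
qed

theorem proposition3:
  fixes Y :: "(real^'l) set"
    and \<Theta> :: "(real^'k) set"
    and P :: "(real^'l \<Rightarrow> real) set"
    and f :: "real^'l \<Rightarrow> real^'k \<Rightarrow> real"
    and \<phi> :: "real^'l \<Rightarrow> real^'k \<Rightarrow> real^'k"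
    and \<Omega> :: "real^'k^'k"
  assumes Y: "Y \<in> sets borel"
    and true_densities: "\<forall>p\<in>P. is_density Y p"
    and model_densities: "\<forall>\<theta>\<in>\<Theta>. is_density Y (\<lambda>y. f y \<theta>)"
    and supports: "\<forall>p\<in>P. \<forall>\<theta>\<in>\<Theta>. density_support Y p \<subseteq> density_support Y (\<lambda>y. f y \<theta>)"
    and \<Omega>: "sym_pos_def \<Omega>"
    and \<phi>_measurable: "\<forall>\<theta>\<in>\<Theta>. (\<lambda>y. \<phi> y \<theta>) \<in> borel_measurable (restrict_space lborel Y)"
    and \<Theta>: "open \<Theta>" "convex \<Theta>"
    and \<phi>_range: "\<forall>p\<in>P. \<forall>\<theta>\<in>\<Theta>. AE y in law Y p. \<phi> y \<theta> \<in> \<Theta>"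
    and log_f: "\<forall>x\<in>Y. (\<forall>\<theta>\<in>\<Theta>. 0 < f x \<theta>) \<and> C2_on \<Theta> (\<lambda>\<theta>. ln (f x \<theta>))"
    and score_integrable: "\<forall>p\<in>P. \<forall>\<theta>\<in>\<Theta>. integrable (law Y p) (\<lambda>x. score f x \<theta>)"
    and upd_square_integrable:
      "\<forall>p\<in>P. \<forall>\<theta>\<in>\<Theta>. integrable (law Y p) (\<lambda>y. (norm (upd_diff \<phi> y \<theta>))\<^sup>2)"
  shows "\<forall>p\<in>P. \<forall>\<theta>\<in>\<Theta>. \<forall>\<theta>s. is_pseudo_true Y \<Theta> f p \<theta>s \<longrightarrow>
    ((\<integral>y. upd_diff \<phi> y \<theta> \<partial>law Y p) \<bullet> (\<Omega> *v (\<theta>s - \<theta>)) > 0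
     \<longleftrightarrow>
     (\<exists>\<kappa>b. 0 < \<kappa>b \<and> \<kappa>b \<le> 1 \<and>
        (\<forall>\<kappa>\<in>{0<..\<kappa>b}. delta_mse (law Y p) \<Omega> \<theta>s (downscaled \<phi> \<kappa>) \<theta> < 0)))"
proof (intro ballI allI impI)
  fix p \<theta> \<theta>s
  assume p: "p \<in> P" and \<theta>: "\<theta> \<in> \<Theta>"
  let ?M = "law Y p" and ?D = "\<lambda>y. upd_diff \<phi> y \<theta>"
  have prob: "prob_space ?M"
    using true_densities p by (simp add: is_density_def)
  have sym: "transpose \<Omega> = \<Omega>" and pos: "0 \<le> v \<bullet> (\<Omega> *v v)" for v
    using \<Omega> by (cases "v = 0"; force simp: sym_pos_def_def)+
  have "(\<lambda>y. \<phi> y \<theta>) \<in> borel_measurable ?M"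
    using \<phi>_measurable \<theta> by (simp add: law_def)
  then have meas: "?D \<in> borel_measurable ?M"
    unfolding upd_diff_def by measurable
  have sq: "integrable ?M (\<lambda>y. (norm (?D y))\<^sup>2)"
    using upd_square_integrable p \<theta> by blast
  have A: "0 \<le> (\<integral>y. ?D y \<bullet> (\<Omega> *v ?D y) \<partial>?M)"
    by (rule Bochner_Integration.integral_nonneg) (rule pos)
  show "(\<integral>y. ?D y \<partial>?M) \<bullet> (\<Omega> *v (\<theta>s - \<theta>)) > 0 \<longleftrightarrow>
      (\<exists>\<kappa>b. 0 < \<kappa>b \<and> \<kappa>b \<le> 1 \<and>
        (\<forall>\<kappa>\<in>{0<..\<kappa>b}. delta_mse ?M \<Omega> \<theta>s (downscaled \<phi> \<kappa>) \<theta> < 0))"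
    unfolding delta_mse_downscaled[OF prob sym meas sq]
    by (rule quadratic_negative_near_zero_iff[OF A])
qed

end
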